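(* Let $G_1=(V_1,E_1)$ and $G_2=(V_2,E_2)$ be isomorphic graphs, let $f:V_1\to V_2$ be a graph isomorphism, and let $v\in V_1$ and $w\in V_2$ be vertices with $f(v)=w$. Then the vertex signatures of $v$ in $G_1$ and of $w$ in $G_2$, as computed by the RSVP procedure, are identical: $\mathbb{S}_{G_1}(v)=\mathbb{S}_{G_2}(w)$.
   Context: Graphs are finite, simple, undirected, unlabeled and unweighted. An isomorphism $f:V_1\to V_2$ is a bijection such that $\{u,v\}\in E_1$ if and only if $\{f(u),f(v)\}\in E_2$. For a graph $G=(V,E)$, $N(v)$ denotes the set of neighbours of $v$ and $d_G(x,y)$ the hop distance (length of a shortest path). Fixed data (the same for all graphs): an injective map $\mathcal{P}$ from the nonnegative integers to the set of primes $\ge 3$; a real constant $\kappa$ used as a convention below. The RSVP vertex signature. Let $G=(V,E)$ have $n$ vertices. (1) Pairwise distances: compute $d_G(x,y)$ for all $x,y\in V$ by breadth-first search (BFS) from each vertex. (2) Multi-source reachability: for $v\in V$, let $G'=G-v$ ($v$ and its incident edges are deleted). For each start vertex $s\in N(v)$, run a modified BFS on $G'$ from $s$: each vertex is inserted in the queue and visited once, as in ordinary BFS, but when a vertex $u$ is visited, every edge $\{u,x\}$ of $G'$ incident to $u$ is considered (even if $x$ was already discovered or visited), and an entry "$x$ is reached with hop-distance $d_{G'}(s,u)+1$ from $s$ via the immediate parent $u$" is recorded for $x$. (3) Aggregation: merge the entries over all $s\in N(v)$, measuring hops from $v$ (i.e. adding $1$ for the step from $v$ to $s$). Thus, for $t\in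 V\setminus\{v\}$ and an integer $h\ge 2$, the parent list of $t$ at hop-distance $h$ from $v$ is the set $$pl_h(v\to t)=\{u : \{u,t\}\in E(G'),\ \exists s\in N(v)\ \text{with}\ d_{G'}(s,u)+2=h\},$$ and $pl_1(v\to t)=\{v\}$ if $t\in N(v)$, $pl_1(v\to t)=\emptyset$ otherwise. Let $\mathcal{HP}_{v\to t}$ be the collection of all triples $\langle h@c, pl\rangle$ with $pl=pl_h(v\to t)\neq\emptyset$ and $c=|pl|$ (the number of distinct immediate parents). If there is no such $h$ (in particular for $t=v$, or $t$ not reachable from $v$), set $\mathcal{HP}_{v\to t}=\{\langle 0@0,\emptyset\rangle\}$. (4) Signature: for a finite set $pl$ of vertices with at least two elements, $AvPD(pl)$ is the average of $d_G(x,y)$ over all unordered pairs of distinct $x,y\in pl$; if $|pl|\le 1$, $AvPD(pl)=\kappa$. Put $$\mathcal{S}(v\to t)=\prod_{\langle h@c,pl\rangle\in\mathcal{HP}_{v\to t}} AvPD(pl)\cdot \mathcal{P}(h)^{c}.$$ The signature $\mathbb{S}_G(v)$ is the sequence of the $n$ real numbers $\mathcal{S}(v\to t)$, $t\in V$, sorted in nondecreasing order. *)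

theory Defs
  imports Complex_Main "HOL-Library.Multiset" "HOL-Library.Extended_Nat"
    "HOL-Computational_Algebra.Primes"
begin

definition simple_graph :: "'a set \<Rightarrow> 'a set set \<Rightarrow> bool" where
  "simple_graph V E \<longleftrightarrow> finite V \<and> (\<forall>e\<in>E. e \<subseteq> V \<and> card e = 2)"

definition graph_iso :: "('a \<Rightarrow> 'b) \<Rightarrow> 'a set \<Rightarrow> 'a set set \<Rightarrow> 'b set \<Rightarrow> 'b set set \<Rightarrow> bool" where
  "graph_iso f V1 E1 V2 E2 \<longleftrightarrow>
     bij_betw f V1 V2 \<and> (\<forall>x\<in>V1. \<forall>y\<in>V1. {x, y} \<in> E1 \<longleftrightarrow> {f x, f y} \<in> E2)"

definition neighbours :: "'a set set \<Rightarrow> 'a \<Rightarrow> 'a set" where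
  "neighbours E v = {u. {v, u} \<in> E}"

definition is_path :: "'a set \<Rightarrow> 'a set set \<Rightarrow> 'a list \<Rightarrow> bool" where
  "is_path V E p \<longleftrightarrow>
     p \<noteq> [] \<and> set p \<subseteq> V \<and> distinct p \<and> successively (\<lambda>x y. {x, y} \<in> E) p"

text \<open>The infimum of the empty set is \<open>\<infinity>\<close>, so the distance between vertices in different
  components is \<open>\<infinity>\<close>.\<close>

definition hop_dist :: "'a set \<Rightarrow> 'a set set \<Rightarrow> 'a \<Rightarrow> 'a \<Rightarrow> enat" where
  "hop_dist V E x y =
     (INF p \<in> {p. is_path V E p \<and> hd p = x \<and> last p = y}. enat (length p - 1))"

definition del_vert :: "'a \<Rightarrow> 'a set \<Rightarrow> 'a set" where
  "del_vert v V = V - {v}"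

definition del_vert_edges :: "'a \<Rightarrow> 'a set set \<Rightarrow> 'a set set" where
  "del_vert_edges v E = {e \<in> E. v \<notin> e}"

text \<open>The parents recorded for \<open>t\<close> at hop-distance \<open>h\<close> from \<open>v\<close>. The equation between extended
  naturals forces \<open>u\<close> to be reachable from \<open>s\<close> in the graph without \<open>v\<close>.\<close>

definition parent_list :: "'a set \<Rightarrow> 'a set set \<Rightarrow> 'a \<Rightarrow> 'a \<Rightarrow> nat \<Rightarrow> 'a set" where
  "parent_list V E v t h =
     (if h \<ge> 2 then
        {u. {u, t} \<in> del_vert_edges v E \<and>
            (\<exists>s \<in> neighbours E v. hop_dist (del_vert v V) (del_vert_edges v E) s u + 2 = enat h)}
      else if h = 1 \<and> t \<in> neighbours E v then {v}
      else {})"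

text \<open>A triple \<open>(h, c, pl)\<close> stands for the entry \<open>\<langle>h@c, pl\<rangle>\<close>. No separate case for \<open>t = v\<close> is
  needed, since all parent lists of \<open>v\<close> itself are empty.\<close>

definition hop_parents :: "'a set \<Rightarrow> 'a set set \<Rightarrow> 'a \<Rightarrow> 'a \<Rightarrow> (nat \<times> nat \<times> 'a set) set" where
  "hop_parents V E v t =
     (let T = {(h, c, pl). pl = parent_list V E v t h \<and> pl \<noteq> {} \<and> c = card pl}
      in if T = {} then {(0, 0, {})} else T)"

text \<open>The distance of the two members of an unordered pair, well defined because \<open>hop_dist\<close> is
  symmetric (see \<open>pair_dist_insert\<close> below).\<close>

definition pair_dist :: "'a set \<Rightarrow> 'a set set \<Rightarrow> 'a set \<Rightarrow> enat" where
  "pair_dist V E e = (THE d. \<exists>x y. e = {x, y} \<and> d = hop_dist V E x y)"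

text \<open>Parent lists with at least two elements consist of neighbours of a common vertex, so every
  distance averaged in the signature is finite and \<open>the_enat\<close> is harmless.\<close>

definition AvPD :: "real \<Rightarrow> 'a set \<Rightarrow> 'a set set \<Rightarrow> 'a set \<Rightarrow> real" where
  "AvPD \<kappa> V E pl =
     (let prs = {e. e \<subseteq> pl \<and> card e = 2}
      in if card pl \<ge> 2
         then (\<Sum>e\<in>prs. real (the_enat (pair_dist V E e))) / real (card prs)
         else \<kappa>)"

definition target_sig ::
    "(nat \<Rightarrow> nat) \<Rightarrow> real \<Rightarrow> 'a set \<Rightarrow> 'a set set \<Rightarrow> 'a \<Rightarrow> 'a \<Rightarrow> real" where
  "target_sig P \<kappa> V E v t =
     (\<Prod>(h, c, pl) \<in> hop_parents V E v t. AvPD \<kappa> V E pl * real (P h) ^ c)"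

definition vertex_sig ::
    "(nat \<Rightarrow> nat) \<Rightarrow> real \<Rightarrow> 'a set \<Rightarrow> 'a set set \<Rightarrow> 'a \<Rightarrow> real list" where
  "vertex_sig P \<kappa> V E v =
     sorted_list_of_multiset (image_mset (target_sig P \<kappa> V E v) (mset_set V))"

lemma is_path_rev: "is_path V E (rev p) \<longleftrightarrow> is_path V E p"
  by (simp add: is_path_def insert_commute)

lemma hop_dist_sym: "hop_dist V E x y = hop_dist V E y x"
proof -
  have le: "hop_dist V E x y \<le> hop_dist V E y x" for x y
    unfolding hop_dist_def
  proof (rule INF_mono)
    fix p assume "p \<in> {p. is_path V E p \<and> hd p = y \<and> last p = x}"
    then show "\<exists>q \<in> {p. is_path V E p \<and> hd p = x \<and> last p = y}.
        enat (length q - 1) \<le> enat (length p - 1)"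
      by (intro bexI[of _ "rev p"]) (auto simp: is_path_rev hd_rev last_rev)
  qed
  show ?thesis by (intro antisym le)
qed

lemma pair_dist_insert: "pair_dist V E {x, y} = hop_dist V E x y"
  unfolding pair_dist_def
  by (rule the_equality) (auto simp: doubleton_eq_iff hop_dist_sym)

lemma finite_hop_parents:
  assumes "simple_graph V E"
  shows "finite (hop_parents V E v t)"
proof -
  have N: "neighbours E v \<subseteq> V" "{u. {u, t} \<in> E} \<subseteq> V" for v t
    using assms by (auto simp: simple_graph_def neighbours_def)
  have fin: "finite V" using assms by (simp add: simple_graph_def)
  let ?d = "\<lambda>(s, u). the_enat (hop_dist (del_vert v V) (del_vert_edges v E) s u + 2)"
  have "{h. parent_list V E v t h \<noteq> {}} \<subseteq> insert 1 (?d ` (V \<times> V))"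
  proof
    fix h assume "h \<in> {h. parent_list V E v t h \<noteq> {}}"
    then consider "h = 1" | s u where "{u, t} \<in> E" "s \<in> neighbours E v"
        "hop_dist (del_vert v V) (del_vert_edges v E) s u + 2 = enat h"
      by (auto simp: parent_list_def del_vert_edges_def split: if_splits)
    then show "h \<in> insert 1 (?d ` (V \<times> V))"
    proof cases
      case 2
      then have "h = ?d (s, u)" by simp
      moreover have "(s, u) \<in> V \<times> V" using 2 N by auto
      ultimately show ?thesis by blast
    qed simp
  qed
  then have "finite {h. parent_list V E v t h \<noteq> {}}"
    using fin by (meson finite_SigmaI finite_imageI finite_insert finite_subset)
  moreover have "{(h, c, pl). pl = parent_list V E v t h \<and> pl \<noteq> {} \<and> c = card pl} =
      (\<lambda>h. (h, card (parent_list V E v t h), parent_list V E v t h)) `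
        {h. parent_list V E v t h \<noteq> {}}"
    by auto
  ultimately show ?thesis by (simp add: hop_parents_def Let_def)
qed

end

theory Submission imports Defs begin

text \<open>Every ingredient of the signature is determined by adjacency alone, so an isomorphism
  transports it. Distances are invariant because \<open>f\<close> and its inverse both carry paths
  to paths (\<open>hop_dist_iso\<close>). As \<open>f\<close> restricts to an isomorphism between
  the graphs without \<open>v\<close> and without \<open>f v\<close>, it maps parent lists onto
  parent lists (\<open>parent_list_iso\<close>). Entries thus correspond with the same hop and count
  and with average distances that agree (\<open>AvPD_iso\<close>), which makes the products over
  them equal (\<open>target_sig_iso\<close>). Sorting discards the naming of targets, so the
  bijection of vertices finishes the proof.\<close>

lemma graph_iso_inv_into:
  assumes "graph_iso f V1 E1 V2 E2"
  shows "graph_iso (inv_into V1 f) V2 E2 V1 E1"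
proof -
  have bij: "bij_betw f V1 V2" and
    E: "\<And>x y. x \<in> V1 \<Longrightarrow> y \<in> V1 \<Longrightarrow> {x, y} \<in> E1 \<longleftrightarrow> {f x, f y} \<in> E2"
    using assms by (auto simp: graph_iso_def)
  have "{x, y} \<in> E2 \<longleftrightarrow> {inv_into V1 f x, inv_into V1 f y} \<in> E1" if "x \<in> V2" "y \<in> V2" for x y
    using that E[of "inv_into V1 f x" "inv_into V1 f y"] bij
    by (simp add: bij_betw_inv_into_right bij_betw_apply[OF bij_betw_inv_into])
  then show ?thesis
    using bij by (simp add: graph_iso_def bij_betw_inv_into)
qed

lemma is_path_map:
  assumes "graph_iso f V1 E1 V2 E2" and "is_path V1 E1 p"
  shows "is_path V2 E2 (map f p)"
proof -
  have "successively (\<lambda>x y. {f x, f y} \<in> E2) p"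
    using assms by (auto simp: is_path_def graph_iso_def elim!: successively_mono)
  then show ?thesis
    using assms
    by (auto simp: is_path_def graph_iso_def successively_map distinct_map bij_betw_def
        intro: inj_on_subset)
qed

text \<open>Each path has an image path of the same length, so the infimum for the images ranges
  over at least those lengths. If no path exists, the right-hand side is infinite. Only one
  inequality is shown, since the other is this one applied to the inverse.\<close>

lemma hop_dist_iso_le:
  assumes "graph_iso f V1 E1 V2 E2"
  shows "hop_dist V2 E2 (f x) (f y) \<le> hop_dist V1 E1 x y"
  unfolding hop_dist_def
proof (rule INF_mono)
  fix p assume p: "p \<in> {p. is_path V1 E1 p \<and> hd p = x \<and> last p = y}"
  then have "p \<noteq> []" by (auto simp: is_path_def)
  with p show "\<exists>q \<in> {q. is_path V2 E2 q \<and> hd q = f x \<and> last q = f y}.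
      enat (length q - 1) \<le> enat (length p - 1)"
    by (intro bexI[of _ "map f p"]) (auto simp: is_path_map[OF assms] hd_map last_map)
qed

lemma hop_dist_iso:
  assumes iso: "graph_iso f V1 E1 V2 E2" and "x \<in> V1" "y \<in> V1"
  shows "hop_dist V2 E2 (f x) (f y) = hop_dist V1 E1 x y"
proof -
  have "inj_on f V1" using iso by (simp add: graph_iso_def bij_betw_def)
  then show ?thesis
    using hop_dist_iso_le[OF iso, of x y]
      hop_dist_iso_le[OF graph_iso_inv_into[OF iso], of "f x" "f y"] assms(2,3)
    by simp
qed

lemma graph_iso_del_vert:
  assumes "graph_iso f V1 E1 V2 E2" and "v \<in> V1"
  shows "graph_iso f (del_vert v V1) (del_vert_edges v E1)
           (del_vert (f v) V2) (del_vert_edges (f v) E2)"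
proof -
  have "bij_betw f (V1 - {v}) (V2 - {f v})"
    using assms by (auto simp: graph_iso_def bij_betw_def inj_on_def)
  \<comment> \<open>Injectivity makes edges avoiding \<open>v\<close> correspond to edges avoiding
    \<open>f v\<close>.\<close>
  moreover have "f v = f x \<longleftrightarrow> v = x" if "x \<in> V1" for x
    using assms that by (auto simp: graph_iso_def bij_betw_def inj_on_def)
  ultimately show ?thesis
    using assms(1) by (auto simp: graph_iso_def del_vert_def del_vert_edges_def)
qed

lemma simple_graph_del_vert:
  "simple_graph V E \<Longrightarrow> simple_graph (del_vert v V) (del_vert_edges v E)"
  by (auto simp: simple_graph_def del_vert_def del_vert_edges_def)

lemma simple_graph_edgeD: "simple_graph V E \<Longrightarrow> {x, y} \<in> E \<Longrightarrow> x \<in> V \<and> y \<in> V"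
  by (auto simp: simple_graph_def)

lemma neighbours_subset: "simple_graph V E \<Longrightarrow> neighbours E v \<subseteq> V"
  by (auto simp: neighbours_def dest: simple_graph_edgeD)

text \<open>\<open>graph_iso\<close> speaks only of pairs inside \<open>V1\<close>, while
  \<open>neighbours\<close> ranges over the whole type; simplicity of both graphs confines the
  neighbours to the vertex sets.\<close>

lemma neighbours_iso:
  assumes "simple_graph V1 E1" "simple_graph V2 E2" "graph_iso f V1 E1 V2 E2" "v \<in> V1"
  shows "neighbours E2 (f v) = f ` neighbours E1 v"
proof -
  have V2: "V2 = f ` V1"
    using assms(3) by (simp add: graph_iso_def bij_betw_def)
  have E: "{v, x} \<in> E1 \<longleftrightarrow> {f v, f x} \<in> E2" if "x \<in> V1" for x
    using assms(3,4) that by (simp add: graph_iso_def)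
  show ?thesis
    using E V2 neighbours_subset[OF assms(1), of v] neighbours_subset[OF assms(2), of "f v"]
    by (fastforce simp: neighbours_def)
qed

text \<open>Expressing parents as neighbours of \<open>t\<close> in the graph without
  \<open>v\<close> lets \<open>neighbours_iso\<close> be applied to that graph.\<close>

lemma parent_list_eq:
  "parent_list V E v t h =
     (if h \<ge> 2 then
        {u \<in> neighbours (del_vert_edges v E) t.
          \<exists>s \<in> neighbours E v. hop_dist (del_vert v V) (del_vert_edges v E) s u + 2 = enat h}
      else if h = 1 \<and> t \<in> neighbours E v then {v} else {})"
  by (auto simp: parent_list_def neighbours_def insert_commute)

lemma parent_list_target:
  "parent_list V E v v h = (if h = 1 \<and> v \<in> neighbours E v then {v} else {})"
  by (auto simp: parent_list_def del_vert_edges_def)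

lemma parent_list_subset:
  assumes "simple_graph V E" "v \<in> V"
  shows "parent_list V E v t h \<subseteq> V"
  using assms neighbours_subset[OF simple_graph_del_vert[OF assms(1)], of v t]
  by (auto simp: parent_list_eq del_vert_def)

lemma not_self_neighbour: "simple_graph V E \<Longrightarrow> v \<notin> neighbours E v"
  by (auto simp: simple_graph_def neighbours_def)

lemma parent_list_iso:
  assumes sg: "simple_graph V1 E1" "simple_graph V2 E2"
    and iso: "graph_iso f V1 E1 V2 E2" and "v \<in> V1" "t \<in> V1"
  shows "parent_list V2 E2 (f v) (f t) h = f ` parent_list V1 E1 v t h"
\<comment> \<open>The main argument needs \<open>t\<close> to survive the deletion of
  \<open>v\<close>. For \<open>t = v\<close> both parent lists are empty, because there are no
  loops.\<close>
proof (cases "t = v")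
  case True
  then show ?thesis
    using sg by (simp add: parent_list_target not_self_neighbour)
next
  case False
  let ?V1 = "del_vert v V1" and ?V2 = "del_vert (f v) V2"
  let ?E1 = "del_vert_edges v E1" and ?E2 = "del_vert_edges (f v) E2"
  have iso': "graph_iso f ?V1 ?E1 ?V2 ?E2"
    using graph_iso_del_vert[OF iso \<open>v \<in> V1\<close>] .
  have t: "t \<in> ?V1" using \<open>t \<in> V1\<close> False by (simp add: del_vert_def)
  have N: "neighbours E2 (f v) = f ` neighbours E1 v"
    by (rule neighbours_iso[OF sg iso \<open>v \<in> V1\<close>])
  have N': "neighbours ?E2 (f t) = f ` neighbours ?E1 t"
    by (rule neighbours_iso[OF sg[THEN simple_graph_del_vert] iso' t])
  \<comment> \<open>Start vertices and candidate parents lie in the reduced graph, as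
    \<open>hop_dist_iso\<close> requires there.\<close>
  have sub: "neighbours ?E1 t \<subseteq> ?V1" "neighbours E1 v \<subseteq> ?V1"
    using neighbours_subset[OF simple_graph_del_vert[OF sg(1)], of v t]
      neighbours_subset[OF sg(1), of v] not_self_neighbour[OF sg(1), of v]
    by (auto simp: del_vert_def)
  have d: "hop_dist ?V2 ?E2 (f s) (f u) = hop_dist ?V1 ?E1 s u"
    if "s \<in> neighbours E1 v" "u \<in> neighbours ?E1 t" for s u
    using hop_dist_iso[OF iso'] that sub by blast
  have inj: "inj_on f V1"
    using iso by (simp add: graph_iso_def bij_betw_def)
  \<comment> \<open>This settles the hop-distance 1 case, where the parent list is
    \<open>{v}\<close> or empty.\<close>
  then have "f t \<in> neighbours E2 (f v) \<longleftrightarrow> t \<in> neighbours E1 v"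
    unfolding N using neighbours_subset[OF sg(1)] \<open>t \<in> V1\<close> by (meson inj_on_image_mem_iff)
  with d show ?thesis
    by (auto simp: parent_list_eq N N' intro!: imageI)
qed

text \<open>Counts agree because \<open>f\<close> is injective on parent lists. The default triple
  is fixed by the map and arises on both sides simultaneously, since an image is empty only if its
  source is.\<close>

lemma hop_parents_iso:
  assumes sg: "simple_graph V1 E1" "simple_graph V2 E2"
    and iso: "graph_iso f V1 E1 V2 E2" and "v \<in> V1" "t \<in> V1"
  shows "hop_parents V2 E2 (f v) (f t) = (\<lambda>(h, c, pl). (h, c, f ` pl)) ` hop_parents V1 E1 v t"
proof -
  have "card (f ` parent_list V1 E1 v t h) = card (parent_list V1 E1 v t h)" for h
    using iso parent_list_subset[OF sg(1) \<open>v \<in> V1\<close>]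
    by (meson bij_betw_def card_image graph_iso_def inj_on_subset)
  then have "{(h, c, pl). pl = parent_list V2 E2 (f v) (f t) h \<and> pl \<noteq> {} \<and> c = card pl} =
      (\<lambda>(h, c, pl). (h, c, f ` pl)) `
        {(h, c, pl). pl = parent_list V1 E1 v t h \<and> pl \<noteq> {} \<and> c = card pl}"
    by (auto simp: parent_list_iso[OF assms] image_iff)
  then show ?thesis
    by (simp add: hop_parents_def Let_def)
qed

lemma hop_parents_subset:
  assumes "simple_graph V E" "v \<in> V" "(h, c, pl) \<in> hop_parents V E v t"
  shows "pl \<subseteq> V"
  using assms(3) parent_list_subset[OF assms(1,2)]
  by (auto simp: hop_parents_def Let_def split: if_splits)

lemma pair_dist_iso:
  assumes "graph_iso f V1 E1 V2 E2" "e \<subseteq> V1" "card e = 2"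
  shows "pair_dist V2 E2 (f ` e) = pair_dist V1 E1 e"
proof -
  obtain x y where "e = {x, y}" using assms(3) by (auto simp: card_2_iff)
  then show ?thesis
    using assms(2) hop_dist_iso[OF assms(1)] by (simp add: pair_dist_insert)
qed

text \<open>The two-element subsets of the image are exactly the images of two-element subsets, so
  sum and denominator can be reindexed; equal cardinalities select the same branch, including the
  \<open>\<kappa>\<close> convention.\<close>

lemma AvPD_iso:
  assumes iso: "graph_iso f V1 E1 V2 E2" and "pl \<subseteq> V1"
  shows "AvPD \<kappa> V2 E2 (f ` pl) = AvPD \<kappa> V1 E1 pl"
proof -
  let ?prs = "{e. e \<subseteq> pl \<and> card e = 2}"
  have inj: "inj_on f pl"
    using assms by (auto simp: graph_iso_def bij_betw_def intro: inj_on_subset)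
  have card: "card (f ` e) = card e" if "e \<subseteq> pl" for e
    using inj that by (meson card_image inj_on_subset)
  have prs: "{e. e \<subseteq> f ` pl \<and> card e = 2} = (`) f ` ?prs"
    by (auto simp: subset_image_iff image_iff card)
  have inj': "inj_on ((`) f) ?prs"
    using inj by (auto simp: inj_on_def inj_on_image_eq_iff)
  have "pair_dist V2 E2 (f ` e) = pair_dist V1 E1 e" if "e \<in> ?prs" for e
    using pair_dist_iso[OF iso] that \<open>pl \<subseteq> V1\<close> by auto
  then show ?thesis
    by (simp add: AvPD_def Let_def prs card sum.reindex[OF inj'] card_image[OF inj'])
qed

lemma target_sig_iso:
  assumes sg: "simple_graph V1 E1" "simple_graph V2 E2"
    and iso: "graph_iso f V1 E1 V2 E2" and "v \<in> V1" "t \<in> V1"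
  shows "target_sig P \<kappa> V2 E2 (f v) (f t) = target_sig P \<kappa> V1 E1 v t"
proof -
  let ?g = "\<lambda>(h, c, pl). (h, c, f ` pl)"
  note sub = hop_parents_subset[OF sg(1) \<open>v \<in> V1\<close>]
  have "inj_on f V1"
    using iso by (simp add: graph_iso_def bij_betw_def)
  \<comment> \<open>Taking images under \<open>f\<close> is injective on subsets of
    \<open>V1\<close>, so no two factors of the product merge.\<close>
  then have inj: "inj_on ?g (hop_parents V1 E1 v t)"
    by (auto simp: inj_on_def inj_on_image_eq_iff[OF _ sub sub])
  show ?thesis
    unfolding target_sig_def hop_parents_iso[OF assms] prod.reindex[OF inj]
    by (rule prod.cong) (auto simp: AvPD_iso[OF iso sub])
qed

theorem theorem1:
  fixes P :: "nat \<Rightarrow> nat" and \<kappa> :: real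
    and V1 :: "'a set" and E1 :: "'a set set"
    and V2 :: "'b set" and E2 :: "'b set set"
    and f :: "'a \<Rightarrow> 'b" and v :: 'a and w :: 'b
  assumes "inj P" and "\<And>i. prime (P i) \<and> P i \<ge> 3"
    and "simple_graph V1 E1" and "simple_graph V2 E2"
    and "graph_iso f V1 E1 V2 E2"
    and "v \<in> V1" and "w \<in> V2" and "f v = w"
  shows "vertex_sig P \<kappa> V1 E1 v = vertex_sig P \<kappa> V2 E2 w"
proof -
  have bij: "bij_betw f V1 V2"
    using \<open>graph_iso f V1 E1 V2 E2\<close> by (simp add: graph_iso_def)
  have fin: "finite V1"
    using \<open>simple_graph V1 E1\<close> by (simp add: simple_graph_def)
  \<comment> \<open>The signature depends only on the multiset of target values, so reindexing the
    targets along \<open>f\<close> suffices.\<close>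
  have "mset_set V2 = image_mset f (mset_set V1)"
    using bij by (simp add: image_mset_mset_set bij_betw_def)
  moreover have "target_sig P \<kappa> V2 E2 w (f t) = target_sig P \<kappa> V1 E1 v t" if "t \<in> V1" for t
    using target_sig_iso[OF assms(3-6) that] \<open>f v = w\<close> by simp
  ultimately have "image_mset (target_sig P \<kappa> V1 E1 v) (mset_set V1) =
      image_mset (target_sig P \<kappa> V2 E2 w) (mset_set V2)"
    using fin by (simp add: multiset.map_comp) (auto intro!: image_mset_cong)
  then show ?thesis
    by (simp add: vertex_sig_def)
qed

end
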